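(* Let the kernel pair $(M(x),K(x))$ belong to the Luchko set $\mathcal{L}_1(\mathbb{R}_+)$. Let $g(x)$ be an increasing and positive monotone function on $[a,b)$ with $-\infty<a<b<+\infty$, having a nonzero continuous first-order derivative $g^{(1)}(x)\ne0$ for all $x\in(a,b)$. Then the left-sided and right-sided parametric general fractional derivatives of Riemann-Liouville type satisfy the equalities $$(D^{(K)}_{a+,g}f)(x)=Q_g\,(D^{(K)}_{g(a)+}\,Q_g^{-1}f)(x),$$ if $f\in C^1_{-1,g}(a,b]$, i.e. $f(g^{-1}(x))\in C^1_{-1}(a,b]$, and $$(D^{(K)}_{b-,g}f)(x)=Q_g\,(D^{(K)}_{g(b)-}\,Q_g^{-1}f)(x),$$ if $f\in C^1_{-1,g}[a,b)$, i.e. $f(g^{-1}(x))\in C^1_{-1}[a,b)$.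
   Context: Substitution operators: $(Q_gf)(x)=f(g(x))$ and $(Q_g^{-1}f)(x)=f(g^{-1}(x))$, where $g^{-1}$ is the inverse function of $g$. $f\in C^1_{-1,g}(a,b]$ means that the first-order derivative of $f$ can be represented as $f^{(1)}(x)=(g(x)-g(a))^p\,v_p(x)$ with $v_p\in C[a,b]$ and $p>-1$. $f\in C^1_{-1,g}[a,b)$ means that $f^{(1)}(x)=(g(b)-g(x))^q\,v_q(x)$ with $v_q\in C[a,b]$ and $q>-1$. $C^1_{-1}(a,b]$ and $C^1_{-1}[a,b)$ are these classes for $g(x)=x$. The Luchko set $\mathcal{L}_1(\mathbb{R}_+)$ consists of the pairs $(M(x),K(x))$, $x\in\mathbb{R}_+=(0,\infty)$, such that $M,K\in C_{-1}(0,b-a]$ and the Sonin condition holds: $$\int_0^x M(x-z)K(z)\,dz=\begin{cases}1,& x\in(0,b-a],\\ 0,& x\notin(0,b-a].\end{cases}$$ Here $F\in C_{-1}(0,b-a]$ means $F(x)=x^pG(x)$ for some $G\in C[0,b-a]$ and $p>-1$. Parametric derivatives of Riemann-Liouville type, for $a<x\le b$ (left-sided) and $a\le x<b$ (right-sided): $$(D^{(K)}_{a+,g}f)(x)=\frac{1}{g^{(1)}(x)}\frac{d}{dx}\int_a^x K(g(x)-g(u))f(u)g^{(1)}(u)\,du,$$ $$(D^{(K)}_{b-,g}f)(x)=-\frac{1}{g^{(1)}(x)}\frac{d}{dx}\int_x^b K(g(u)-g(x))f(u)g^{(1)}(u)\,du.$$ Non-parametric ones on a finite interval $(c,d)$ (the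 case $g(x)=x$): $$(D^{(K)}_{c+}\varphi)(x)=\frac{d}{dx}\int_c^x K(x-u)\varphi(u)\,du,\qquad (D^{(K)}_{d-}\varphi)(x)=-\frac{d}{dx}\int_x^d K(u-x)\varphi(u)\,du.$$ *)

theory Defs
  imports "HOL-Analysis.Analysis"
begin

text \<open>\<open>C\<^bsub>-1\<^esub>(0,L]\<close>; members are functions on the half-line, constrained only on \<open>(0,L]\<close>.\<close>

definition Cm1 :: "real \<Rightarrow> (real \<Rightarrow> real) set" where
  "Cm1 L = {F. \<exists>p G. p > -1 \<and> continuous_on {0..L} G \<and> (\<forall>x\<in>{0<..L}. F x = x powr p * G x)}"

text \<open>Luchko set for the interval length \<open>L\<close>. Existence of the Sonin integral is required
  explicitly, because the Lebesgue integral of a non-integrable function is \<open>0\<close> by convention.\<close>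

definition Luchko :: "real \<Rightarrow> ((real \<Rightarrow> real) \<times> (real \<Rightarrow> real)) set" where
  "Luchko L = {(M, K). M \<in> Cm1 L \<and> K \<in> Cm1 L \<and>
     (\<forall>x>0. set_integrable lebesgue {0<..<x} (\<lambda>z. M (x - z) * K z) \<and>
       (LINT z:{0<..<x}|lebesgue. M (x - z) * K z) = (if x \<in> {0<..L} then 1 else 0))}"

text \<open>\<open>C\<^sup>1\<^bsub>-1,g\<^esub>(a,b]\<close> and \<open>C\<^sup>1\<^bsub>-1,g\<^esub>[a,b)\<close>. The derivative at the closed end of the interval
  is one-sided. The classes without \<open>g\<close> are those for the identity.\<close>

definition C1_left :: "(real \<Rightarrow> real) \<Rightarrow> real \<Rightarrow> real \<Rightarrow> (real \<Rightarrow> real) set" where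
  "C1_left g a b = {f. \<exists>p v. p > -1 \<and> continuous_on {a..b} v \<and>
     (\<forall>x\<in>{a<..b}. (f has_real_derivative (g x - g a) powr p * v x) (at x within {a<..b}))}"

definition C1_right :: "(real \<Rightarrow> real) \<Rightarrow> real \<Rightarrow> real \<Rightarrow> (real \<Rightarrow> real) set" where
  "C1_right g a b = {f. \<exists>q v. q > -1 \<and> continuous_on {a..b} v \<and>
     (\<forall>x\<in>{a..<b}. (f has_real_derivative (g b - g x) powr q * v x) (at x within {a..<b}))}"

text \<open>The range type is arbitrary, so that \<open>Qop\<close> also acts on partial functions.\<close>

definition Qop :: "(real \<Rightarrow> real) \<Rightarrow> (real \<Rightarrow> 'r) \<Rightarrow> real \<Rightarrow> 'r" where
  "Qop g f = (\<lambda>x. f (g x))"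

definition Qinv :: "real \<Rightarrow> real \<Rightarrow> (real \<Rightarrow> real) \<Rightarrow> (real \<Rightarrow> 'r) \<Rightarrow> real \<Rightarrow> 'r" where
  "Qinv a b g f = (\<lambda>y. f (inv_into {a..b} g y))"

text \<open>\<open>d/dx \<integral>\<^bsub>I x\<^esub> F x u du\<close> as a partial function of \<open>x \<in> S\<close>: it is defined at \<open>x\<close> iff the integrals
  exist for all points of \<open>S\<close> near \<open>x\<close> and the derivative (one-sided at an end point belonging
  to \<open>S\<close>) exists at \<open>x\<close>. Hence an equation between two such values says that both sides exist
  and agree or that neither side exists; conventional values of undefined integrals and
  derivatives play no role.\<close>

definition deriv_int ::
  "real set \<Rightarrow> (real \<Rightarrow> real set) \<Rightarrow> (real \<Rightarrow> real \<Rightarrow> real) \<Rightarrow> real \<rightharpoonup> real" where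
  "deriv_int S I F x =
     (if x \<in> S
       \<and> (\<forall>\<^sub>F t in nhds x. t \<in> S \<longrightarrow> set_integrable lebesgue (I t) (F t))
       \<and> (\<lambda>t. LINT u:I t|lebesgue. F t u) differentiable (at x within S)
      then Some (vector_derivative (\<lambda>t. LINT u:I t|lebesgue. F t u) (at x within S))
      else None)"

definition RL_left ::
  "(real \<Rightarrow> real) \<Rightarrow> real \<Rightarrow> real \<Rightarrow> (real \<Rightarrow> real) \<Rightarrow> real \<rightharpoonup> real" where
  "RL_left K c d \<phi> = deriv_int {c<..d} (\<lambda>x. {c<..<x}) (\<lambda>x u. K (x - u) * \<phi> u)"

definition RL_right ::
  "(real \<Rightarrow> real) \<Rightarrow> real \<Rightarrow> real \<Rightarrow> (real \<Rightarrow> real) \<Rightarrow> real \<rightharpoonup> real" where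
  "RL_right K c d \<phi> =
     (\<lambda>x. map_option uminus (deriv_int {c..<d} (\<lambda>x. {x<..<d}) (\<lambda>x u. K (u - x) * \<phi> u) x))"

text \<open>\<open>g\<^sup>(\<^sup>1\<^sup>)\<close> on \<open>[a,b]\<close>, one-sided at the end points.\<close>

definition der1 :: "real \<Rightarrow> real \<Rightarrow> (real \<Rightarrow> real) \<Rightarrow> real \<Rightarrow> real" where
  "der1 a b g x = vector_derivative g (at x within {a..b})"

definition nonzero_der1 :: "real \<Rightarrow> real \<Rightarrow> (real \<Rightarrow> real) \<Rightarrow> real \<Rightarrow> bool" where
  "nonzero_der1 a b g x \<longleftrightarrow> g differentiable (at x within {a..b}) \<and> der1 a b g x \<noteq> 0"

text \<open>The parametric derivatives are undefined where the factor \<open>1 / g\<^sup>(\<^sup>1\<^sup>)(x)\<close> is.\<close>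

definition RL_left_par ::
  "(real \<Rightarrow> real) \<Rightarrow> (real \<Rightarrow> real) \<Rightarrow> real \<Rightarrow> real \<Rightarrow> (real \<Rightarrow> real) \<Rightarrow> real \<rightharpoonup> real" where
  "RL_left_par K g a b f = (\<lambda>x. if nonzero_der1 a b g x then
     map_option (\<lambda>D. 1 / der1 a b g x * D)
       (deriv_int {a<..b} (\<lambda>x. {a<..<x}) (\<lambda>x u. K (g x - g u) * f u * der1 a b g u) x)
     else None)"

definition RL_right_par ::
  "(real \<Rightarrow> real) \<Rightarrow> (real \<Rightarrow> real) \<Rightarrow> real \<Rightarrow> real \<Rightarrow> (real \<Rightarrow> real) \<Rightarrow> real \<rightharpoonup> real" where
  "RL_right_par K g a b f = (\<lambda>x. if nonzero_der1 a b g x then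
     map_option (\<lambda>D. - (1 / der1 a b g x) * D)
       (deriv_int {a..<b} (\<lambda>x. {x<..<b}) (\<lambda>x u. K (g u - g x) * f u * der1 a b g u) x)
     else None)"

end

theory Submission
  imports Defs
begin

text \<open>The substitution \<open>y = g u\<close> turns the parametric integral at \<open>x\<close> into the non-parametric one at
  \<open>g x\<close>, and existence of either integral implies existence of the other. Since \<open>g\<close> is a
  homeomorphism with \<open>g' x \<noteq> 0\<close>, the chain rule for \<open>g\<close> and for its inverse shows that either outer
  derivative exists iff the other does, and they differ by the factor \<open>g' x\<close>.

  For existence, write \<open>\<phi> y = A + \<integral>\<^bsub>c\<^esub>\<^bsup>y\<^esup> \<psi>\<close> with \<open>\<psi> = \<phi>'\<close>. By Fubini the fractional integral of \<open>\<phi>\<close> is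
  a primitive of \<open>A K(x - c) + (K * \<psi>)(x)\<close>, and this function is continuous away from \<open>c\<close>.
  The right-sided case is the left-sided one reflected at \<open>0\<close>.\<close>

subsection \<open>Derivatives of parameter integrals under a change of variables\<close>


text \<open>Integrability and value are separated, because \<open>deriv_int\<close> tracks existence
  of the integral on its own. If one side is not integrable, neither is the other, and both
  integrals take the default value 0.\<close>

lemma set_integral_lebesgue_change_of_variables:
  fixes F g g' :: "real \<Rightarrow> real"
  assumes "S \<in> sets lebesgue"
    and "\<And>x. x \<in> S \<Longrightarrow> (g has_real_derivative g' x) (at x within S)"
    and "inj_on g S"
  shows "set_integrable lebesgue (g ` S) F \<longleftrightarrow> set_integrable lebesgue S (\<lambda>x. \<bar>g' x\<bar> * F (g x))"
    and "(LINT y:g ` S|lebesgue. F y) = (LINT x:S|lebesgue. \<bar>g' x\<bar> * F (g x))"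
proof -
  note cov = has_absolute_integral_change_of_variables_1'[OF assms, of F]
  show *: "set_integrable lebesgue (g ` S) F \<longleftrightarrow> set_integrable lebesgue S (\<lambda>x. \<bar>g' x\<bar> * F (g x))"
    using cov by blast
  show "(LINT y:g ` S|lebesgue. F y) = (LINT x:S|lebesgue. \<bar>g' x\<bar> * F (g x))"
  proof (cases "set_integrable lebesgue (g ` S) F")
    case True
    then show ?thesis
      using * cov by (metis set_lebesgue_integral_eq_integral(2))
  next
    case False
    then show ?thesis
      using * by (simp add: set_lebesgue_integral_def set_integrable_def not_integrable_integral_eq)
  qed
qed

text \<open>A nontrivial filter makes the derivative unique, so \<open>vector_derivative\<close>
  returns exactly the given \<open>D\<close>.\<close>

lemma deriv_int_eq_Some_iff:
  assumes "at x within S \<noteq> bot"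
  shows "deriv_int S I F x = Some D \<longleftrightarrow>
    x \<in> S \<and> (\<forall>\<^sub>F t in nhds x. t \<in> S \<longrightarrow> set_integrable lebesgue (I t) (F t)) \<and>
    ((\<lambda>t. LINT u:I t|lebesgue. F t u) has_real_derivative D) (at x within S)"
proof -
  have "f differentiable (at x within S) \<and> vector_derivative f (at x within S) = D
      \<longleftrightarrow> (f has_real_derivative D) (at x within S)" for f :: "real \<Rightarrow> real"
    using vector_derivative_within[OF assms, of f] vector_derivative_works[of f "at x within S"]
      differentiableI_vector[of f D "at x within S"]
    by (auto simp: has_real_derivative_iff_has_vector_derivative)
  then show ?thesis
    by (auto simp: deriv_int_def)
qed

lemma eventually_nhds_relative_compose:
  assumes "continuous (at x within S) h" "h \<in> S \<rightarrow> T" "x \<in> S"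
    and ev: "\<forall>\<^sub>F s in nhds (h x). s \<in> T \<longrightarrow> P s"
  shows "\<forall>\<^sub>F t in nhds x. t \<in> S \<longrightarrow> P (h t)"
proof -
  \<comment> \<open>The filter \<open>at x within S\<close> omits the point \<open>x\<close> itself;
    the value there comes from the assumption about \<open>nhds (h x)\<close>, which covers
    \<open>h x\<close>.\<close>
  have "P (h x)"
    using eventually_nhds_x_imp_x[OF ev] assms(2,3) by auto
  have "(h \<longlongrightarrow> h x) (at x within S)"
    using assms(1) by (simp add: continuous_within)
  from filterlim_iff[THEN iffD1, OF this, rule_format, OF ev]
  have "\<forall>\<^sub>F t in nhds x. t \<noteq> x \<longrightarrow> t \<in> S \<longrightarrow> h t \<in> T \<longrightarrow> P (h t)"
    by (simp add: eventually_at_filter)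
  then show ?thesis
    by eventually_elim (use \<open>P (h x)\<close> assms(2) in auto)
qed

text \<open>One direction of the transport: existence near \<open>h x\<close> is pulled back by
  continuity of \<open>h\<close>, the outer derivative by the chain rule. The opposite direction is
  this lemma applied to the inverse of \<open>h\<close>.\<close>

lemma deriv_int_compose:
  assumes "at x within S \<noteq> bot" "at (h x) within T \<noteq> bot" "x \<in> S" "h \<in> S \<rightarrow> T"
    and der: "(h has_real_derivative c) (at x within S)"
    and int: "\<And>t. t \<in> S \<Longrightarrow>
      set_integrable lebesgue (I t) (F t) \<longleftrightarrow> set_integrable lebesgue (J (h t)) (G (h t))"
    and eq: "\<And>t. t \<in> S \<Longrightarrow> (LINT u:I t|lebesgue. F t u) = (LINT u:J (h t)|lebesgue. G (h t) u)"
    and D: "deriv_int T J G (h x) = Some D"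
  shows "deriv_int S I F x = Some (c * D)"
proof -
  from D have ev: "\<forall>\<^sub>F s in nhds (h x). s \<in> T \<longrightarrow> set_integrable lebesgue (J s) (G s)"
    and dG: "((\<lambda>s. LINT u:J s|lebesgue. G s u) has_real_derivative D) (at (h x) within T)"
    by (auto simp: deriv_int_eq_Some_iff[OF assms(2)])
  have "continuous (at x within S) h"
    using der by (rule DERIV_continuous)
  from eventually_nhds_relative_compose[OF this assms(4,3) ev]
  have ev': "\<forall>\<^sub>F t in nhds x. t \<in> S \<longrightarrow> set_integrable lebesgue (I t) (F t)"
    by eventually_elim (simp add: int)
  have "((\<lambda>s. LINT u:J s|lebesgue. G s u) has_real_derivative D) (at (h x) within h ` S)"
    using dG by (rule has_field_derivative_subset) (use assms(4) in auto)
  from DERIV_image_chain[OF this der]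
  have "((\<lambda>t. LINT u:J (h t)|lebesgue. G (h t) u) has_real_derivative D * c) (at x within S)"
    by (simp add: o_def)
  then have "((\<lambda>t. LINT u:I t|lebesgue. F t u) has_real_derivative c * D) (at x within S)"
    by (subst mult.commute)
       (rule has_field_derivative_transform_within[where d = 1], use assms(3) eq in auto)
  with ev' assms(3) show ?thesis
    by (simp add: deriv_int_eq_Some_iff[OF assms(1)])
qed

text \<open>Stated relative to a set, so that it also yields one-sided derivatives of the inverse at
  end points.\<close>

lemma DERIV_inverse_within:
  fixes f g :: "real \<Rightarrow> real"
  assumes der: "(f has_real_derivative c) (at x within S)" and "c \<noteq> 0" "x \<in> S"
    and gf: "\<And>t. t \<in> S \<Longrightarrow> g (f t) = t"
    and cont: "continuous (at (f x) within f ` S) g"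
  shows "(g has_real_derivative 1 / c) (at (f x) within f ` S)"
proof -
  have "(g has_derivative (\<lambda>y. y / c)) (at (f x) within f ` S)"
  proof (rule has_derivative_inverse_within[OF _ cont \<open>x \<in> S\<close> _ _ gf])
    show "(f has_derivative (*) c) (at x within S)"
      using der by (simp add: has_field_derivative_def)
    show "linear (\<lambda>y. y / c)"
      using bounded_linear_divide bounded_linear.linear by blast
    show "(\<lambda>y. y / c) \<circ> (*) c = id"
      using \<open>c \<noteq> 0\<close> by (auto simp: fun_eq_iff)
  qed
  moreover have "(\<lambda>y. y / c) = (*) (1 / c)"
    by (auto simp: fun_eq_iff)
  ultimately show ?thesis
    by (simp add: has_field_derivative_def)
qed

text \<open>A defined right side gives the left side by the chain rule for \<open>h\<close>. If the
  right side is undefined, a value \<open>D\<close> on the left would be carried over by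
  \<open>k\<close>, whose derivative is \<open>1 / c\<close>, to a value on the right; hence both
  are undefined.\<close>

lemma deriv_int_homeomorphic:
  assumes "at x within S \<noteq> bot" "at (h x) within h ` S \<noteq> bot" "x \<in> S"
    and der: "(h has_real_derivative c) (at x within S)" and "c \<noteq> 0"
    and kh: "\<And>t. t \<in> S \<Longrightarrow> k (h t) = t"
    and cont: "continuous (at (h x) within h ` S) k"
    and int: "\<And>t. t \<in> S \<Longrightarrow>
      set_integrable lebesgue (I t) (F t) \<longleftrightarrow> set_integrable lebesgue (J (h t)) (G (h t))"
    and eq: "\<And>t. t \<in> S \<Longrightarrow> (LINT u:I t|lebesgue. F t u) = (LINT u:J (h t)|lebesgue. G (h t) u)"
  shows "deriv_int S I F x = map_option ((*) c) (deriv_int (h ` S) J G (h x))"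
proof (cases "deriv_int (h ` S) J G (h x)")
  case (Some D)
  then show ?thesis
    using deriv_int_compose[OF assms(1-3) _ der int eq Some] by auto
next
  case None
  have "deriv_int S I F x = None"
  proof (cases "deriv_int S I F x")
    case (Some D)
    have "deriv_int (h ` S) J G (h x) = Some (1 / c * D)"
      by (rule deriv_int_compose[OF assms(2) _ _ _ DERIV_inverse_within[OF der \<open>c \<noteq> 0\<close> \<open>x \<in> S\<close> kh cont]])
         (use assms(1,3) kh int eq Some in auto)
    with None show ?thesis by simp
  qed
  with None show ?thesis by simp
qed

text \<open>The derivative -1 of the reflection cancels the minus sign in
  \<open>RL_right\<close>.\<close>

lemma RL_right_eq_RL_left_reflect:
  assumes "x \<in> {c..<d}"
  shows "RL_right K c d \<phi> x = RL_left K (- d) (- c) (\<lambda>y. \<phi> (- y)) (- x)"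
proof -
  have "deriv_int {c..<d} (\<lambda>x. {x<..<d}) (\<lambda>x u. K (u - x) * \<phi> u) x =
     map_option ((*) (-1)) (deriv_int (uminus ` {c..<d}) (\<lambda>x. {- d<..<x}) (\<lambda>x u. K (x - u) * \<phi> (- u)) (- x))"
  proof (rule deriv_int_homeomorphic)
    show "at x within {c..<d} \<noteq> bot"
      using assms by (auto simp: trivial_limit_within islimpt_Ico)
    show "at (- x) within uminus ` {c..<d} \<noteq> bot"
      using assms by (auto simp: trivial_limit_within islimpt_Ioc)
    show "x \<in> {c..<d}" by fact
    show "(uminus has_real_derivative -1) (at x within {c..<d})"
      by (auto intro!: derivative_eq_intros)
    show "continuous (at (- x) within uminus ` {c..<d}) uminus"
      by (intro continuous_intros)
    fix t assume "t \<in> {c..<d}"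
    have "(uminus has_real_derivative -1) (at u within {t<..<d})" for u :: real
      by (auto intro!: derivative_eq_intros)
    note cov = set_integral_lebesgue_change_of_variables[of "{t<..<d}" uminus "\<lambda>_. -1"
        "\<lambda>u. K (- t - u) * \<phi> (- u)", OF _ this]
    show "set_integrable lebesgue {t<..<d} (\<lambda>u. K (u - t) * \<phi> u) \<longleftrightarrow>
        set_integrable lebesgue {- d<..<- t} (\<lambda>u. K (- t - u) * \<phi> (- u))"
      using cov(1) by simp
    show "(LINT u:{t<..<d}|lebesgue. K (u - t) * \<phi> u) =
        (LINT u:{- d<..<- t}|lebesgue. K (- t - u) * \<phi> (- u))"
      using cov(2) by simp
  qed auto
  then show ?thesis
    by (auto simp: RL_right_def RL_left_def option.map_comp o_def option.map_ident)
qed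


subsection \<open>Monotone substitutions\<close>

text \<open>Only weak inequalities survive the limit at \<open>b\<close>; strictness is saved by a
  point \<open>m\<close> placed between \<open>x\<close> and \<open>b\<close>.\<close>

lemma strict_mono_on_Icc_of_Ico:
  fixes g :: "real \<Rightarrow> real"
  assumes mono: "strict_mono_on {a..<b} g" and cont: "continuous_on {a..b} g"
  shows "strict_mono_on {a..b} g"
proof (rule strict_mono_onI)
  fix x y assume xy: "x \<in> {a..b}" "y \<in> {a..b}" "x < y"
  show "g x < g y"
  proof (cases "y = b")
    case False
    then show ?thesis
      using xy by (intro strict_mono_onD[OF mono]) auto
  next
    case True
    obtain m where m: "x < m" "m < b"
      using dense xy True by blast
    have "g x < g m"
      using xy m by (intro strict_mono_onD[OF mono]) auto
    also have "g m \<le> g b"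
    proof (rule tendsto_lowerbound)
      show "(g \<longlongrightarrow> g b) (at_left b)"
        using cont by (rule continuous_on_Icc_at_leftD) (use xy True in auto)
      show "\<forall>\<^sub>F t in at_left b. g m \<le> g t"
      proof -
        have "\<forall>\<^sub>F t in at_left b. t \<in> {m<..<b}"
          using m eventually_at_left_real by blast
        then show ?thesis
        proof eventually_elim
          case (elim t)
          have "g m < g t"
            by (rule strict_mono_onD[OF mono]) (use elim m xy in auto)
          then show ?case by simp
        qed
      qed
    qed simp
    finally show ?thesis using True by simp
  qed
qed

text \<open>The intermediate value theorem gives the closed interval; injectivity lets end points be
  removed on both sides for the other three.\<close>

lemma strict_mono_continuous_image:
  fixes g :: "real \<Rightarrow> real"
  assumes mono: "strict_mono_on {a..b} g" and cont: "continuous_on {a..b} g"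
    and st: "a \<le> s" "s \<le> t" "t \<le> b"
  shows "g ` {s<..<t} = {g s<..<g t}"
    and "g ` {s<..t} = {g s<..g t}"
    and "g ` {s..<t} = {g s..<g t}"
    and "g ` {s..t} = {g s..g t}"
proof -
  have le: "g x \<le> g y" if "x \<in> {s..t}" "y \<in> {s..t}" "x \<le> y" for x y
    by (rule strict_mono_on_leD[OF mono]) (use that st in auto)
  have "y \<in> g ` {s..t}" if "y \<in> {g s..g t}" for y
    using IVT'[of g s y t] that st continuous_on_subset[OF cont, of "{s..t}"] by force
  then show Icc: "g ` {s..t} = {g s..g t}"
    using le st by (auto simp del: image_iff)
  have diff: "g ` ({s..t} - B) = {g s..g t} - g ` B" if "B \<subseteq> {s..t}" for B
    unfolding Icc[symmetric]
    by (rule inj_on_image_set_diff[OF strict_mono_on_imp_inj_on[OF mono]]) (use that st in auto)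
  have Ioo: "{s<..<t} = {s..t} - {s, t}" "{s<..t} = {s..t} - {s}" "{s..<t} = {s..t} - {t}"
    by auto
  show "g ` {s<..<t} = {g s<..<g t}" "g ` {s<..t} = {g s<..g t}" "g ` {s..<t} = {g s..<g t}"
    unfolding Ioo using st by (auto simp: diff)
qed

lemma der1_eq:
  assumes "a < b" "x \<in> {a..b}" "(g has_real_derivative D) (at x within {a..b})"
  shows "der1 a b g x = D"
  using assms unfolding der1_def
  by (intro vector_derivative_within_closed_interval)
     (auto simp: has_real_derivative_iff_has_vector_derivative)

lemma nonzero_der1_imp_DERIV:
  assumes "nonzero_der1 a b g x"
  shows "(g has_real_derivative der1 a b g x) (at x within {a..b})"
  using assms vector_derivative_works[of g]
  by (auto simp: nonzero_der1_def der1_def has_real_derivative_iff_has_vector_derivative)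

lemma set_lebesgue_integral_cong_on:
  assumes "A = B" "\<And>x. x \<in> B \<Longrightarrow> f x = g x"
  shows "(LINT x:A|M. f x) = (LINT x:B|M. g x)"
  using assms unfolding set_lebesgue_integral_def
  by (intro Bochner_Integration.integral_cong) (auto simp: indicator_def)

text \<open>Monotonicity and continuity cover the closed interval, which makes
  \<open>inv_into {a..b} g\<close> a continuous inverse up to the ends, while differentiability is
  confined to the interior. A one-sided derivative at an end point enters pointwise through
  \<open>nonzero_der1\<close>.\<close>

locale monotone_substitution =
  fixes a b :: real and g :: "real \<Rightarrow> real"
  assumes ab: "a < b"
    and mono: "strict_mono_on {a..b} g"
    and cont: "continuous_on {a..b} g"
    and der: "\<And>x. x \<in> {a<..<b} \<Longrightarrow> (g has_real_derivative deriv g x) (at x)"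
    and nonzero: "\<And>x. x \<in> {a<..<b} \<Longrightarrow> deriv g x \<noteq> 0"
begin

section \<open>Inverse and derivative of the substitution\<close>

lemma inj: "inj_on g {a..b}"
  using mono by (rule strict_mono_on_imp_inj_on)

lemma g_less: "a \<le> x \<Longrightarrow> x < y \<Longrightarrow> y \<le> b \<Longrightarrow> g x < g y"
  using mono by (auto intro: strict_mono_onD)

lemma inv_g: "t \<in> {a..b} \<Longrightarrow> inv_into {a..b} g (g t) = t"
  using inj by (rule inv_into_f_f)

lemmas g_image = strict_mono_continuous_image[OF mono cont]

lemma continuous_on_inv_g: "continuous_on {g a..g b} (inv_into {a..b} g)"
  using continuous_on_inv[OF cont, of "inv_into {a..b} g"] g_image(4)[of a b] ab inv_g by simp

lemma continuous_inv_g: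
  assumes "x \<in> {a..b}" "S \<subseteq> {a..b}"
  shows "continuous (at (g x) within g ` S) (inv_into {a..b} g)"
proof -
  have "g ` {a..b} = {g a..g b}"
    using g_image(4)[of a b] ab by simp
  moreover have "g x \<in> g ` {a..b}"
    using assms(1) by blast
  ultimately have "continuous (at (g x) within g ` {a..b}) (inv_into {a..b} g)"
    using continuous_on_inv_g by (simp add: continuous_on_eq_continuous_within)
  then show ?thesis
    by (rule continuous_within_subset) (use assms in auto)
qed

lemma der1_interior: "x \<in> {a<..<b} \<Longrightarrow> der1 a b g x = deriv g x"
  using der[of x] ab by (intro der1_eq) (auto intro: has_field_derivative_at_within)

lemma nonzero_der1_interior: "x \<in> {a<..<b} \<Longrightarrow> nonzero_der1 a b g x"
proof -
  assume x: "x \<in> {a<..<b}"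
  from has_field_derivative_at_within[OF der[OF x]]
  have "g differentiable (at x within {a..b})"
    by (auto simp: has_real_derivative_iff_has_vector_derivative intro: differentiableI_vector)
  with x show "nonzero_der1 a b g x"
    by (simp add: nonzero_der1_def der1_interior nonzero)
qed

lemma deriv_nonneg: "x \<in> {a<..<b} \<Longrightarrow> 0 \<le> deriv g x"
  by (rule mono_on_imp_deriv_nonneg[OF strict_mono_on_imp_mono_on[OF mono] der]) auto

text \<open>The open interval stays where \<open>g\<close> is differentiable, and
  \<open>deriv g\<close> is nonnegative there by monotonicity, so the Jacobian
  \<open>\<bar>deriv g u\<bar>\<close> is \<open>der1 a b g u\<close>.\<close>

lemma
  assumes "a \<le> s" "s \<le> t" "t \<le> b"
  shows set_integrable_substitution:
      "set_integrable lebesgue {s<..<t} (\<lambda>u. F (g u) * der1 a b g u) \<longleftrightarrow>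
       set_integrable lebesgue {g s<..<g t} F" (is ?int)
    and set_integral_substitution:
      "(LINT u:{s<..<t}|lebesgue. F (g u) * der1 a b g u) = (LINT y:{g s<..<g t}|lebesgue. F y)"
      (is ?eq)
proof -
  have sub: "{s<..<t} \<subseteq> {a<..<b}"
    using assms by auto
  have eq: "F (g u) * der1 a b g u = \<bar>deriv g u\<bar> * F (g u)" if "u \<in> {s<..<t}" for u
    using deriv_nonneg[of u] der1_interior[of u] sub that by auto
  have "inj_on g {s<..<t}"
    using inj by (rule inj_on_subset) (use sub in auto)
  moreover have "(g has_real_derivative deriv g u) (at u within {s<..<t})" if "u \<in> {s<..<t}" for u
    using der[of u] sub that by (blast intro: has_field_derivative_at_within)
  ultimately have cov:
    "set_integrable lebesgue {g s<..<g t} F \<longleftrightarrow> set_integrable lebesgue {s<..<t} (\<lambda>u. \<bar>deriv g u\<bar> * F (g u))"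
    "(LINT y:{g s<..<g t}|lebesgue. F y) = (LINT u:{s<..<t}|lebesgue. \<bar>deriv g u\<bar> * F (g u))"
    using set_integral_lebesgue_change_of_variables[of "{s<..<t}" g "deriv g" F] g_image(1)[OF assms]
    by auto
  show ?int
    unfolding cov(1) by (rule set_integrable_cong[OF refl refl eq])
  show ?eq
    unfolding cov(2) by (rule set_lebesgue_integral_cong_on[OF refl eq])
qed

text \<open>This is \<open>deriv_int_homeomorphic\<close> with \<open>h = g\<close>: the factor
  \<open>der1 a b g x\<close> that it produces cancels the prefactor of \<open>RL_left_par\<close>.
  Asking for a nonzero derivative only at \<open>x\<close> lets the end point \<open>b\<close> be
  included.\<close>

lemma RL_left_par_eq:
  assumes "x \<in> {a<..b}" and nz: "nonzero_der1 a b g x"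
  shows "RL_left_par K g a b f x = RL_left K (g a) (g b) (Qinv a b g f) (g x)"
proof -
  let ?c = "der1 a b g x" and ?k = "inv_into {a..b} g"
  have "deriv_int {a<..b} (\<lambda>x. {a<..<x}) (\<lambda>x u. K (g x - g u) * f u * der1 a b g u) x =
    map_option ((*) ?c) (deriv_int (g ` {a<..b}) (\<lambda>y. {g a<..<y}) (\<lambda>y z. K (y - z) * f (?k z)) (g x))"
  proof (rule deriv_int_homeomorphic)
    show "at x within {a<..b} \<noteq> bot"
      using assms(1) by (auto simp: trivial_limit_within islimpt_Ioc)
    show "at (g x) within g ` {a<..b} \<noteq> bot"
      using assms(1) ab g_less[of a b] g_less[of a x] g_less[of x b] g_image(2)[of a b]
      by (cases "x = b") (auto simp: trivial_limit_within islimpt_Ioc)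
    show "(g has_real_derivative ?c) (at x within {a<..b})"
      by (rule has_field_derivative_subset[OF nonzero_der1_imp_DERIV[OF nz]]) auto
    show "?c \<noteq> 0"
      using nz by (simp add: nonzero_der1_def)
    show "continuous (at (g x) within g ` {a<..b}) ?k"
      using assms(1) by (intro continuous_inv_g) auto
    fix t assume t: "t \<in> {a<..b}"
    \<comment> \<open>Writing \<open>f u\<close> as \<open>f (?k (g u))\<close> makes the integrand
      a function of \<open>g u\<close> times the derivative of \<open>g\<close>, the form that the
      substitution rule takes.\<close>
    have eq: "K (g t - g u) * f u * der1 a b g u = K (g t - g u) * f (?k (g u)) * der1 a b g u"
      if "u \<in> {a<..<t}" for u
      using t inv_g[of u] that by auto
    note subst = set_integrable_substitution[of a t "\<lambda>z. K (g t - z) * f (?k z)"]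
      set_integral_substitution[of a t "\<lambda>z. K (g t - z) * f (?k z)"]
    have "set_integrable lebesgue {a<..<t} (\<lambda>u. K (g t - g u) * f u * der1 a b g u) \<longleftrightarrow>
        set_integrable lebesgue {a<..<t} (\<lambda>u. K (g t - g u) * f (?k (g u)) * der1 a b g u)"
      by (rule set_integrable_cong[OF refl refl eq])
    then show "set_integrable lebesgue {a<..<t} (\<lambda>u. K (g t - g u) * f u * der1 a b g u) \<longleftrightarrow>
        set_integrable lebesgue {g a<..<g t} (\<lambda>z. K (g t - z) * f (?k z))"
      using subst(1) t by simp
    have "(LINT u:{a<..<t}|lebesgue. K (g t - g u) * f u * der1 a b g u) =
        (LINT u:{a<..<t}|lebesgue. K (g t - g u) * f (?k (g u)) * der1 a b g u)"
      by (rule set_lebesgue_integral_cong_on[OF refl eq])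
    then show "(LINT u:{a<..<t}|lebesgue. K (g t - g u) * f u * der1 a b g u) =
        (LINT z:{g a<..<g t}|lebesgue. K (g t - z) * f (?k z))"
      using subst(2) t by simp
  qed (use assms(1) inv_g in auto)
  then show ?thesis
    using nz g_image(2)[of a b] ab
    by (simp add: RL_left_par_def RL_left_def Qinv_def nonzero_der1_def option.map_comp o_def option.map_ident)
qed

text \<open>Since \<open>g\<close> preserves orientation, the minus sign of
  \<open>RL_right_par\<close> passes unchanged to the \<open>uminus\<close> in
  \<open>RL_right\<close>.\<close>

lemma RL_right_par_eq:
  assumes "x \<in> {a..<b}" and nz: "nonzero_der1 a b g x"
  shows "RL_right_par K g a b f x = RL_right K (g a) (g b) (Qinv a b g f) (g x)"
proof -
  let ?c = "der1 a b g x" and ?k = "inv_into {a..b} g"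
  have "deriv_int {a..<b} (\<lambda>x. {x<..<b}) (\<lambda>x u. K (g u - g x) * f u * der1 a b g u) x =
    map_option ((*) ?c) (deriv_int (g ` {a..<b}) (\<lambda>y. {y<..<g b}) (\<lambda>y z. K (z - y) * f (?k z)) (g x))"
  proof (rule deriv_int_homeomorphic)
    show "at x within {a..<b} \<noteq> bot"
      using assms(1) by (auto simp: trivial_limit_within islimpt_Ico)
    show "at (g x) within g ` {a..<b} \<noteq> bot"
      using assms(1) ab g_less[of a b] g_less[of a x] g_less[of x b] g_image(3)[of a b]
      by (cases "x = a") (auto simp: trivial_limit_within islimpt_Ico)
    show "(g has_real_derivative ?c) (at x within {a..<b})"
      by (rule has_field_derivative_subset[OF nonzero_der1_imp_DERIV[OF nz]]) auto
    show "?c \<noteq> 0"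
      using nz by (simp add: nonzero_der1_def)
    show "continuous (at (g x) within g ` {a..<b}) ?k"
      using assms(1) by (intro continuous_inv_g) auto
    fix t assume t: "t \<in> {a..<b}"
    have eq: "K (g u - g t) * f u * der1 a b g u = K (g u - g t) * f (?k (g u)) * der1 a b g u"
      if "u \<in> {t<..<b}" for u
      using t inv_g[of u] that by auto
    note subst = set_integrable_substitution[of t b "\<lambda>z. K (z - g t) * f (?k z)"]
      set_integral_substitution[of t b "\<lambda>z. K (z - g t) * f (?k z)"]
    have "set_integrable lebesgue {t<..<b} (\<lambda>u. K (g u - g t) * f u * der1 a b g u) \<longleftrightarrow>
        set_integrable lebesgue {t<..<b} (\<lambda>u. K (g u - g t) * f (?k (g u)) * der1 a b g u)"
      by (rule set_integrable_cong[OF refl refl eq])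
    then show "set_integrable lebesgue {t<..<b} (\<lambda>u. K (g u - g t) * f u * der1 a b g u) \<longleftrightarrow>
        set_integrable lebesgue {g t<..<g b} (\<lambda>z. K (z - g t) * f (?k z))"
      using subst(1) t by simp
    have "(LINT u:{t<..<b}|lebesgue. K (g u - g t) * f u * der1 a b g u) =
        (LINT u:{t<..<b}|lebesgue. K (g u - g t) * f (?k (g u)) * der1 a b g u)"
      by (rule set_lebesgue_integral_cong_on[OF refl eq])
    then show "(LINT u:{t<..<b}|lebesgue. K (g u - g t) * f u * der1 a b g u) =
        (LINT z:{g t<..<g b}|lebesgue. K (z - g t) * f (?k z))"
      using subst(2) t by simp
  qed (use assms(1) inv_g in auto)
  then show ?thesis
    using nz g_image(3)[of a b] ab
    by (simp add: RL_right_par_def RL_right_def Qinv_def nonzero_der1_def option.map_comp o_def)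
qed

end

subsection \<open>Convolutions of weakly singular kernels\<close>

text \<open>The cut-off outside \<open>(0,L]\<close> turns fractional integrals into integrals over
  the whole line, where translations and Fubini act without tracking limits.\<close>

definition powr_kernel :: "real \<Rightarrow> real \<Rightarrow> (real \<Rightarrow> real) \<Rightarrow> real \<Rightarrow> real" where
  "powr_kernel L p G z = indicator {0<..L} z * (z powr p * G z)"

text \<open>For a function supported in \<open>(0,L]\<close> this primitive vanishes at all
  nonpositive arguments.\<close>

definition cumulative :: "(real \<Rightarrow> real) \<Rightarrow> real \<Rightarrow> real" where
  "cumulative j r = (LINT w:{..<r}|lborel. j w)"

definition convolution :: "(real \<Rightarrow> real) \<Rightarrow> (real \<Rightarrow> real) \<Rightarrow> real \<Rightarrow> real" where
  "convolution k \<psi> w = (LINT z|lborel. k z * \<psi> (w - z))"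

section \<open>Integrability and continuity of the cut-off kernels\<close>

lemma powr_kernel_measurable [measurable]:
  assumes "continuous_on UNIV G"
  shows "powr_kernel L p G \<in> borel_measurable borel"
proof -
  have [measurable]: "G \<in> borel_measurable borel"
    using assms by (rule borel_measurable_continuous_onI)
  show ?thesis
    unfolding powr_kernel_def by measurable
qed

lemma bounded_on_Icc:
  fixes G :: "real \<Rightarrow> real"
  assumes "continuous_on UNIV G"
  obtains B where "\<And>z. z \<in> {0..L} \<Longrightarrow> \<bar>G z\<bar> \<le> B"
proof -
  have "compact (G ` {0..L})"
    by (intro compact_continuous_image continuous_on_subset[OF assms]) auto
  then show ?thesis
    using that by (metis bounded_real compact_imp_bounded imageI)
qed

lemma powr_kernel_integrable:
  assumes G: "continuous_on UNIV G" and "p > -1"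
  shows "integrable lborel (powr_kernel L p G)"
proof (cases "0 \<le> L")
  case True
  obtain B where B: "\<And>z. z \<in> {0..L} \<Longrightarrow> \<bar>G z\<bar> \<le> B"
    using bounded_on_Icc[OF G] by blast
  \<comment> \<open>Here \<open>p > -1\<close> enters: it makes the power integrable at 0, and the
    continuous factor is bounded by \<open>B\<close> on the support.\<close>
  have "(\<lambda>z. z powr p) absolutely_integrable_on {0<..L}"
    using assms(2) True by (intro nonnegative_absolutely_integrable_1 integrable_on_powr_from_0') auto
  then have "integrable lborel (\<lambda>z. indicator {0<..L} z * z powr p)"
    unfolding set_integrable_def by (subst (asm) integrable_completion) auto
  then have "integrable lborel (\<lambda>z. indicator {0<..L} z * z powr p * B)"
    by (rule integrable_mult_left)
  then show ?thesis
  proof (rule Bochner_Integration.integrable_bound)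
    have "norm (powr_kernel L p G z) \<le> norm (indicator {0<..L} z * z powr p * B)" for z
    proof (cases "z \<in> {0<..L}")
      case True
      then have "\<bar>G z\<bar> \<le> \<bar>B\<bar>" using B[of z] by auto
      then show ?thesis
        using True by (auto simp: powr_kernel_def abs_mult mult_left_mono)
    qed (simp add: powr_kernel_def)
    then show "AE z in lborel. norm (powr_kernel L p G z) \<le> norm (indicator {0<..L} z * z powr p * B)"
      by simp
  qed (use G in measurable)
next
  case False
  then have "powr_kernel L p G = (\<lambda>_. 0)"
    by (auto simp: powr_kernel_def fun_eq_iff)
  then show ?thesis by simp
qed

lemma powr_kernel_continuous_on:
  assumes "continuous_on UNIV G"
  shows "continuous_on {0<..L} (powr_kernel L p G)"
proof -
  have "continuous_on {0<..L} (\<lambda>z. z powr p * G z)"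
    by (intro continuous_intros continuous_on_subset[OF assms]) auto
  then show ?thesis
    by (rule continuous_on_eq) (auto simp: powr_kernel_def)
qed

text \<open>The fundamental theorem of calculus for an integrable function that may be singular at
  0; at \<open>r = L\<close> the derivative is one-sided.\<close>

lemma cumulative_DERIV:
  assumes j: "integrable lborel j" and cont: "continuous_on {0<..L} j" and r: "r \<in> {0<..L}"
  shows "(cumulative j has_real_derivative j r) (at r within {0<..L})"
proof -
  have int: "set_integrable lborel A j" if "A \<in> sets borel" for A
    using integrable_mult_indicator[OF _ j, of A] that by (simp add: set_integrable_def)
  \<comment> \<open>As \<open>r > 0\<close>, adding the point 0 leaves the filter unchanged; on the
    closed interval the theorem asks for integrability and for continuity at \<open>r\<close>
    only.\<close>
  have at: "at r within {0..L} = at r within {0<..L}"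
    by (rule at_within_nhd[of r "{0<..}"]) (use r in auto)
  have "continuous (at r within {0..L} - {}) j"
    using cont r by (simp add: at continuous_on_eq_continuous_within)
  from integral_has_vector_derivative_continuous_at[OF _ _ _ this]
  have "((\<lambda>u. integral {0..u} j) has_vector_derivative j r) (at r within {0..L} - {})"
    using r set_borel_integral_eq_integral(1)[OF int, of "{0..L}"] by auto
  then have "((\<lambda>u. cumulative j 0 + integral {0..u} j) has_real_derivative j r) (at r within {0<..L})"
    by (auto simp: at has_real_derivative_iff_has_vector_derivative intro!: derivative_eq_intros)
  moreover have "cumulative j 0 + integral {0..u} j = cumulative j u" if "u \<in> {0<..L}" for u
  proof -
    have "cumulative j u = (LINT w:{..<0}\<union>{0..<u}|lborel. j w)"
      using that by (auto simp: cumulative_def intro!: arg_cong2[where f="\<lambda>A. set_lebesgue_integral lborel A"])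
    also have "\<dots> = cumulative j 0 + (LINT w:{0..<u}|lborel. j w)"
      unfolding cumulative_def by (rule set_integral_Un) (auto intro: int)
    also have "(LINT w:{0..<u}|lborel. j w) = integral {0..<u} j"
      by (rule set_borel_integral_eq_integral(2)[OF int]) auto
    also have "\<dots> = integral {0..u} j"
      by (rule integral_subset_negligible) (auto intro: negligible_subset[of "{u}"])
    finally show ?thesis by simp
  qed
  ultimately show ?thesis
    using r by (elim has_field_derivative_transform_within[where d = 1]) auto
qed

text \<open>All three follow from Fubini for \<open>k z * \<psi> (w - z)\<close> on the plane.
  Integrating over \<open>w < s\<close> first turns the inner integral into a shifted primitive of
  \<open>\<psi>\<close>.\<close>

lemma
  assumes k: "integrable lborel k" and \<psi>: "integrable lborel \<psi>"
  shows convolution_integrable: "integrable lborel (convolution k \<psi>)"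
    and integrable_mult_cumulative: "integrable lborel (\<lambda>z. k z * cumulative \<psi> (s - z))"
    and cumulative_convolution:
      "cumulative (convolution k \<psi>) s = (LINT z|lborel. k z * cumulative \<psi> (s - z))"
proof -
  have [measurable]: "k \<in> borel_measurable borel" "\<psi> \<in> borel_measurable borel"
    using k \<psi> by auto
  have shift: "integrable lborel (\<lambda>w. f (w - z))" if "integrable lborel f" for f :: "real \<Rightarrow> real" and z
    using lborel_integrable_real_affine[OF that, of 1 "-z"] by simp
  have shift_eq: "(LINT w|lborel. f (w - z)) = (LINT w|lborel. f w)" for f :: "real \<Rightarrow> real" and z
    using lborel_integral_real_affine[of 1 f "-z"] by simp
  have int: "integrable (lborel \<Otimes>\<^sub>M lborel) (\<lambda>(z, w). k z * \<psi> (w - z))"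
  proof (rule lborel_pair.Fubini_integrable)
    \<comment> \<open>By translation invariance the inner norm integral is a constant multiple of
      \<open>\<bar>k z\<bar>\<close>, which is integrable in \<open>z\<close>.\<close>
    have "(LINT w|lborel. norm (k z * \<psi> (w - z))) = \<bar>k z\<bar> * (LINT w|lborel. \<bar>\<psi> w\<bar>)" for z
      using shift_eq[of "\<lambda>w. \<bar>\<psi> w\<bar>" z] by (simp add: abs_mult)
    then show "integrable lborel (\<lambda>z. LINT w|lborel. norm (case (z, w) of (z, w) \<Rightarrow> k z * \<psi> (w - z)))"
      using k by simp
  qed (use shift[OF \<psi>] in auto)
  show "integrable lborel (convolution k \<psi>)"
    using lborel_pair.integrable_snd[OF int] by (simp add: convolution_def[abs_def])
  have int': "integrable (lborel \<Otimes>\<^sub>M lborel) (\<lambda>(z, w). indicator {..<s} w * (k z * \<psi> (w - z)))"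
    by (rule Bochner_Integration.integrable_bound[OF int]) (auto simp: indicator_def split: prod.split)
  have inner: "(LINT w|lborel. indicator {..<s} w * (k z * \<psi> (w - z))) = k z * cumulative \<psi> (s - z)" for z
  proof -
    have "(LINT w|lborel. indicator {..<s} w * (k z * \<psi> (w - z))) =
        (LINT w|lborel. k z * (indicator {..<s - z} (w - z) * \<psi> (w - z)))"
      by (intro Bochner_Integration.integral_cong) (auto simp: indicator_def)
    also have "\<dots> = k z * cumulative \<psi> (s - z)"
      using shift_eq[of "\<lambda>w. indicator {..<s - z} w * \<psi> w" z]
      by (simp add: cumulative_def set_lebesgue_integral_def)
    finally show ?thesis .
  qed
  show "integrable lborel (\<lambda>z. k z * cumulative \<psi> (s - z))"
    using lborel_pair.integrable_fst[OF int'] by (simp add: inner)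
  show "cumulative (convolution k \<psi>) s = (LINT z|lborel. k z * cumulative \<psi> (s - z))"
    using lborel_pair.Fubini_integral[OF int']
    by (simp add: inner) (simp add: cumulative_def set_lebesgue_integral_def convolution_def)
qed

lemma convolution_powr_kernel_continuous:
  assumes G: "continuous_on UNIV G" and V: "continuous_on UNIV V" and p: "p > -1" and q: "q > -1"
  shows "continuous_on {0<..L} (convolution (powr_kernel L p G) (powr_kernel L q V))"
proof -
  \<comment> \<open>The substitution \<open>z = r * \<tau>\<close> moves both singularities to fixed points.\<close>
  define h where "h r \<tau> = indicator {0<..<1} \<tau> * (\<tau> powr p * (1 - \<tau>) powr q) *
      (G (r * \<tau>) * V (r * (1 - \<tau>)))" for r \<tau> :: real
  \<comment> \<open>The exponent collects \<open>p + q\<close> from the two kernels and 1 from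
    \<open>dz = r d\<tau>\<close>.\<close>
  have eq: "r powr (p + q + 1) * (LINT \<tau>|lborel. h r \<tau>) =
      convolution (powr_kernel L p G) (powr_kernel L q V) r" if r: "r \<in> {0<..L}" for r
  proof -
    have "powr_kernel L p G (r * \<tau>) * powr_kernel L q V (r - r * \<tau>) = r powr (p + q) * h r \<tau>" for \<tau>
    proof (cases "\<tau> \<in> {0<..<1}")
      case True
      then have "r * \<tau> \<le> r" "r * (1 - \<tau>) \<le> r"
        using r by (auto intro!: mult_left_le)
      then have "r * \<tau> \<le> L" "r * (1 - \<tau>) \<le> L"
        using r unfolding greaterThanAtMost_iff by linarith+
      moreover have "0 < r * \<tau>" "0 < r * (1 - \<tau>)"
        using True r by simp_all
      moreover have "r - r * \<tau> = r * (1 - \<tau>)"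
        by (simp add: algebra_simps)
      ultimately show ?thesis
        using True r by (simp add: powr_kernel_def h_def powr_mult powr_add)
    next
      case False
      \<comment> \<open>Outside the open unit interval one kernel argument is nonpositive, where the
        cut-off gives 0.\<close>
      then have "r * \<tau> \<le> 0 \<or> r - r * \<tau> \<le> 0"
        using r by (auto simp: mult_le_0_iff)
      with False show ?thesis
        by (auto simp: powr_kernel_def h_def)
    qed
    then show ?thesis
      using lborel_integral_real_affine[of r "\<lambda>z. powr_kernel L p G z * powr_kernel L q V (r - z)" 0] r
      by (simp add: convolution_def powr_add)
  qed
  obtain BG where BG: "\<And>z. z \<in> {0..L} \<Longrightarrow> \<bar>G z\<bar> \<le> BG"
    using bounded_on_Icc[OF G] by blast
  obtain BV where BV: "\<And>z. z \<in> {0..L} \<Longrightarrow> \<bar>V z\<bar> \<le> BV"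
    using bounded_on_Icc[OF V] by blast
  have [measurable]: "G \<in> borel_measurable borel" "V \<in> borel_measurable borel"
    using G V by (auto intro: borel_measurable_continuous_onI)
  \<comment> \<open>The Beta integral with parameters \<open>p + 1\<close> and \<open>q + 1\<close>
    supplies a dominating function independent of \<open>r\<close>.\<close>
  have "(\<lambda>\<tau>. \<tau> powr p * (1 - \<tau>) powr q) integrable_on {0<..<1}"
    using has_integral_Beta_real[of "p + 1" "q + 1"] p q
    by (auto simp: has_integral_Icc_iff_Ioo integrable_on_def)
  then have "(\<lambda>\<tau>. \<tau> powr p * (1 - \<tau>) powr q) absolutely_integrable_on {0<..<1}"
    by (intro nonnegative_absolutely_integrable_1) auto
  then have "integrable lborel (\<lambda>\<tau>. indicator {0<..<1} \<tau> * (\<tau> powr p * (1 - \<tau>) powr q))"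
    unfolding set_integrable_def by (subst (asm) integrable_completion) auto
  then have dom: "integrable lborel (\<lambda>\<tau>. indicator {0<..<1} \<tau> * (\<tau> powr p * (1 - \<tau>) powr q) * (BG * BV))"
    by (rule integrable_mult_left)
  have "continuous_on {0<..L} (\<lambda>r. LINT \<tau>|lborel. h r \<tau>)"
    unfolding continuous_on_sequentially
  proof (intro allI ballI impI)
    fix X r
    assume r: "r \<in> {0<..L}" and X: "(\<forall>n. X n \<in> {0<..L}) \<and> X \<longlonglongrightarrow> r"
    have "(\<lambda>n. LINT \<tau>|lborel. h (X n) \<tau>) \<longlonglongrightarrow> (LINT \<tau>|lborel. h r \<tau>)"
    proof (rule integral_dominated_convergence[OF _ _ dom])
      show "AE \<tau> in lborel. (\<lambda>n. h (X n) \<tau>) \<longlonglongrightarrow> h r \<tau>"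
      proof (rule AE_I2)
        fix \<tau> :: real
        have "isCont G (r * \<tau>)" "isCont V (r * (1 - \<tau>))"
          using G V by (auto simp: continuous_on_eq_continuous_at)
        moreover have "(\<lambda>n. X n * \<tau>) \<longlonglongrightarrow> r * \<tau>" "(\<lambda>n. X n * (1 - \<tau>)) \<longlonglongrightarrow> r * (1 - \<tau>)"
          using X by (auto intro!: tendsto_mult_right)
        ultimately have "(\<lambda>n. G (X n * \<tau>)) \<longlonglongrightarrow> G (r * \<tau>)"
          "(\<lambda>n. V (X n * (1 - \<tau>))) \<longlonglongrightarrow> V (r * (1 - \<tau>))"
          by (auto intro: isCont_tendsto_compose)
        then show "(\<lambda>n. h (X n) \<tau>) \<longlonglongrightarrow> h r \<tau>"
          unfolding h_def by (intro tendsto_mult tendsto_const)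
      qed
      show "AE \<tau> in lborel. norm (h (X n) \<tau>) \<le> indicator {0<..<1} \<tau> * (\<tau> powr p * (1 - \<tau>) powr q) * (BG * BV)" for n
      proof (rule AE_I2)
        fix \<tau> :: real
        show "norm (h (X n) \<tau>) \<le> indicator {0<..<1} \<tau> * (\<tau> powr p * (1 - \<tau>) powr q) * (BG * BV)"
        proof (cases "\<tau> \<in> {0<..<1}")
          case True
          have Xn: "0 < X n" "X n \<le> L" using X by auto
          have "X n * \<tau> \<le> X n" "X n * (1 - \<tau>) \<le> X n" "0 \<le> X n * \<tau>" "0 \<le> X n * (1 - \<tau>)"
            using Xn True by (auto intro!: mult_left_le)
          with Xn have "X n * \<tau> \<in> {0..L}" "X n * (1 - \<tau>) \<in> {0..L}"
            unfolding atLeastAtMost_iff by linarith+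
          with BG BV have "\<bar>G (X n * \<tau>)\<bar> * \<bar>V (X n * (1 - \<tau>))\<bar> \<le> BG * BV"
            by (meson abs_ge_zero mult_mono order_trans)
          then show ?thesis
            using True by (simp add: h_def abs_mult mult_left_mono)
        qed (simp add: h_def)
      qed
      show "h r \<in> borel_measurable lborel" "h (X n) \<in> borel_measurable lborel" for n
        unfolding h_def by measurable
    qed
    then show "((\<lambda>r. LINT \<tau>|lborel. h r \<tau>) \<circ> X) \<longlonglongrightarrow> (LINT \<tau>|lborel. h r \<tau>)"
      by (simp add: o_def)
  qed
  then have "continuous_on {0<..L} (\<lambda>r. r powr (p + q + 1) * (LINT \<tau>|lborel. h r \<tau>))"
    by (intro continuous_intros) auto
  then show ?thesis
    by (rule continuous_on_eq) (rule eq)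
qed


subsection \<open>Existence of the fractional derivatives\<close>

text \<open>Constant continuation past the end points makes a coefficient continuous on the whole
  line, as the kernel lemmas assume, without changing it on \<open>{l..u}\<close>.\<close>

lemma continuous_on_clamp:
  fixes G :: "real \<Rightarrow> real"
  assumes "continuous_on {l..u} G" "l \<le> u"
  shows "continuous_on UNIV (\<lambda>z. G (max l (min u z)))"
  by (rule continuous_on_compose2[OF assms(1)]) (use assms(2) in \<open>auto intro!: continuous_intros\<close>)

text \<open>The derivative is integrable because \<open>q > -1\<close>. Subtracting its primitive
  from \<open>\<phi>\<close> leaves a function with zero derivative on an interval, hence a constant
  \<open>A\<close>.\<close>

lemma C1_left_representation:
  assumes "c < d" and "\<phi> \<in> C1_left (\<lambda>y. y) c d"
  obtains q V A where "q > -1" "continuous_on UNIV V"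
    "\<forall>y\<in>{c<..d}. \<phi> y = A + cumulative (powr_kernel (d - c) q V) (y - c)"
proof -
  obtain q v where q: "q > -1" and v: "continuous_on {c..d} v"
    and der: "\<And>y. y \<in> {c<..d} \<Longrightarrow> (\<phi> has_real_derivative (y - c) powr q * v y) (at y within {c<..d})"
    using assms(2) by (auto simp: C1_left_def)
  \<comment> \<open>The coefficient \<open>v\<close> is shifted so that the singularity at
    \<open>c\<close> moves to 0, and clamped.\<close>
  define V where "V t = v (max c (min d (c + t)))" for t
  let ?\<psi> = "powr_kernel (d - c) q V"
  have V: "continuous_on UNIV V"
    unfolding V_def
    by (rule continuous_on_compose2[OF continuous_on_clamp[OF v]]) (use assms(1) in \<open>auto intro!: continuous_intros\<close>)
  have "((\<lambda>y. \<phi> y - cumulative ?\<psi> (y - c)) has_real_derivative 0) (at y within {c<..d})"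
    if y: "y \<in> {c<..d}" for y
  proof -
    have img: "(\<lambda>y. y - c) ` {c<..d} = {0<..d - c}"
      using image_add_greaterThanAtMost[of "-c" c d] by (simp add: add.commute)
    have "(cumulative ?\<psi> has_real_derivative ?\<psi> (y - c)) (at (y - c) within {0<..d - c})"
      using y q V by (intro cumulative_DERIV powr_kernel_integrable powr_kernel_continuous_on) auto
    then have "(cumulative ?\<psi> \<circ> (\<lambda>y. y - c) has_real_derivative ?\<psi> (y - c) * 1) (at y within {c<..d})"
      by (intro DERIV_image_chain) (auto simp: img intro!: derivative_eq_intros)
    moreover have "?\<psi> (y - c) = (y - c) powr q * v y"
      using y by (simp add: powr_kernel_def V_def)
    ultimately show ?thesis
      using der[OF y] by (auto simp: o_def intro!: derivative_eq_intros)
  qed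
  then obtain A where "\<And>y. y \<in> {c<..d} \<Longrightarrow> \<phi> y - cumulative ?\<psi> (y - c) = A"
    using has_field_derivative_zero_constant[of "{c<..d}" "\<lambda>y. \<phi> y - cumulative ?\<psi> (y - c)"]
    by (auto simp: convex_real_interval)
  then have "\<forall>y\<in>{c<..d}. \<phi> y = A + cumulative ?\<psi> (y - c)"
    by (simp add: algebra_simps)
  with q V show ?thesis by (rule that)
qed

lemma RL_left_defined:
  assumes cd: "c < d" and K: "K \<in> Cm1 (d - c)" and \<phi>: "\<phi> \<in> C1_left (\<lambda>y. y) c d"
    and x: "x \<in> {c<..d}"
  shows "x \<in> dom (RL_left K c d \<phi>)"
proof -
  let ?L = "d - c"
  obtain p G0 where p: "p > -1" and G0: "continuous_on {0..?L} G0"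
    and K_eq: "\<And>z. z \<in> {0<..?L} \<Longrightarrow> K z = z powr p * G0 z"
    using K by (auto simp: Cm1_def)
  define G where "G z = G0 (max 0 (min ?L z))" for z
  have G: "continuous_on UNIV G"
    unfolding G_def using cd by (intro continuous_on_clamp G0) auto
  obtain q V A where q: "q > -1" and V: "continuous_on UNIV V"
    and \<phi>_eq: "\<forall>y\<in>{c<..d}. \<phi> y = A + cumulative (powr_kernel ?L q V) (y - c)"
    by (rule C1_left_representation[OF cd \<phi>])
  let ?k = "powr_kernel ?L p G" and ?\<psi> = "powr_kernel ?L q V"
  have k: "integrable lborel ?k" and \<psi>: "integrable lborel ?\<psi>"
    using p q G V by (auto intro: powr_kernel_integrable)
  have kK: "?k z = K z" if "z \<in> {0<..?L}" for z
    using that K_eq by (simp add: powr_kernel_def G_def)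
  \<comment> \<open>With \<open>r = t - c\<close>, \<open>E r\<close> will be the fractional
    integral and \<open>e r z\<close> its integrand in the variable \<open>z = t - u\<close>. The
    first summand of \<open>e\<close> is cut at \<open>z < r\<close>; the second ends there by
    itself, since \<open>cumulative ?\<psi>\<close> vanishes at nonpositive arguments.\<close>
  define E where "E r = A * cumulative ?k r + cumulative (convolution ?k ?\<psi>) r" for r
  define e where "e r z = A * (indicator {..<r} z * ?k z) + ?k z * cumulative ?\<psi> (r - z)" for r z
  have e_int: "integrable lborel (e r)" for r
    unfolding e_def[abs_def] using k integrable_mult_indicator[OF _ k, of "{..<r}"]
    by (intro Bochner_Integration.integrable_add integrable_mult_right integrable_mult_cumulative[OF k \<psi>]) auto
  have e_eq: "(LINT z|lborel. e r z) = E r" for r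
    using integrable_mult_indicator[OF _ k, of "{..<r}"] integrable_mult_cumulative[OF k \<psi>]
    by (simp add: e_def[abs_def] E_def cumulative_convolution[OF k \<psi>])
       (simp add: cumulative_def set_lebesgue_integral_def)
  have cumulative_0: "cumulative ?\<psi> t = 0" if "t \<le> 0" for t
  proof -
    have "indicator {..<t} w *\<^sub>R ?\<psi> w = 0" for w
      using that by (auto simp: indicator_def powr_kernel_def)
    then show ?thesis
      by (simp only: cumulative_def set_lebesgue_integral_def) simp
  qed
  have integrand: "indicator {c<..<t} u *\<^sub>R (K (t - u) * \<phi> u) = e (t - c) (t - u)"
    if t: "t \<in> {c<..d}" for t u
  proof -
    \<comment> \<open>For \<open>u \<le> c\<close> the indicator and the shifted primitive in
      \<open>e\<close> are 0; for \<open>t \<le> u\<close> the kernel is 0.\<close>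
    consider "u \<in> {c<..<t}" | "u \<le> c" | "t \<le> u"
      by force
    then show ?thesis
    proof cases
      case 1
      then show ?thesis
        using t kK[of "t - u"] \<phi>_eq by (simp add: e_def algebra_simps)
    next
      case 2
      then show ?thesis
        using cumulative_0[of "u - c"] by (simp add: e_def)
    next
      case 3
      then show ?thesis
        by (simp add: e_def powr_kernel_def)
    qed
  qed
  have int: "set_integrable lebesgue {c<..<t} (\<lambda>u. K (t - u) * \<phi> u)"
    and eq: "(LINT u:{c<..<t}|lebesgue. K (t - u) * \<phi> u) = E (t - c)" if t: "t \<in> {c<..d}" for t
  proof -
    \<comment> \<open>The reflection \<open>z = t - u\<close> preserves the measure, and Borel
      measurability of the integrand makes the passage to the completion harmless.\<close>
    have refl: "integrable lborel (\<lambda>u. e (t - c) (t - u))"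
      using lborel_integrable_real_affine[OF e_int[of "t - c"], of "-1" t] by simp
    then show "set_integrable lebesgue {c<..<t} (\<lambda>u. K (t - u) * \<phi> u)"
      unfolding set_integrable_def integrand[OF t] by (subst integrable_completion) auto
    have "(LINT u|lebesgue. e (t - c) (t - u)) = (LINT u|lborel. e (t - c) (t - u))"
      using refl by (intro integral_completion) auto
    also have "\<dots> = E (t - c)"
      using lborel_integral_real_affine[of "-1" "e (t - c)" t] e_eq by simp
    finally show "(LINT u:{c<..<t}|lebesgue. K (t - u) * \<phi> u) = E (t - c)"
      unfolding set_lebesgue_integral_def integrand[OF t] .
  qed
  have img: "(\<lambda>y. y - c) ` {c<..d} = {0<..?L}"
    using image_add_greaterThanAtMost[of "-c" c d] by (simp add: add.commute)
  \<comment> \<open>Both summands of \<open>E\<close> are primitives of functions continuous on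
    \<open>{0<..?L}\<close>, so \<open>cumulative_DERIV\<close> applies, also at the right
    end.\<close>
  have "(E has_real_derivative A * ?k (x - c) + convolution ?k ?\<psi> (x - c)) (at (x - c) within {0<..?L})"
    unfolding E_def[abs_def]
    by (intro DERIV_add DERIV_cmult cumulative_DERIV k convolution_integrable[OF k \<psi>]
        powr_kernel_continuous_on G convolution_powr_kernel_continuous V p q) (use x in auto)
  then have "(E \<circ> (\<lambda>y. y - c) has_real_derivative (A * ?k (x - c) + convolution ?k ?\<psi> (x - c)) * 1)
      (at x within {c<..d})"
    by (intro DERIV_image_chain) (auto simp: img intro!: derivative_eq_intros)
  from has_field_derivative_transform_within[OF this zero_less_one x,
      of "\<lambda>t. LINT u:{c<..<t}|lebesgue. K (t - u) * \<phi> u"] eq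
  have "((\<lambda>t. LINT u:{c<..<t}|lebesgue. K (t - u) * \<phi> u) has_real_derivative
      A * ?k (x - c) + convolution ?k ?\<psi> (x - c)) (at x within {c<..d})"
    by simp
  moreover have "at x within {c<..d} \<noteq> bot"
    using x by (auto simp: trivial_limit_within islimpt_Ioc)
  ultimately have "RL_left K c d \<phi> x = Some (A * ?k (x - c) + convolution ?k ?\<psi> (x - c))"
    using x int by (simp add: RL_left_def deriv_int_eq_Some_iff)
  then show ?thesis by (simp add: domIff)
qed

section \<open>Transfer of existence to the right-sided derivative\<close>

lemma C1_right_reflect:
  assumes "\<phi> \<in> C1_right (\<lambda>y. y) c d"
  shows "(\<lambda>y. \<phi> (- y)) \<in> C1_left (\<lambda>y. y) (- d) (- c)"
proof -
  obtain q v where q: "q > -1" and v: "continuous_on {c..d} v"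
    and der: "\<And>y. y \<in> {c..<d} \<Longrightarrow> (\<phi> has_real_derivative (d - y) powr q * v y) (at y within {c..<d})"
    using assms by (auto simp: C1_right_def)
  \<comment> \<open>The minus sign of the chain rule is absorbed into the continuous factor.\<close>
  have "continuous_on {- d..- c} (\<lambda>y. - v (- y))"
    by (intro continuous_on_minus continuous_on_compose2[OF v]) (auto intro!: continuous_intros)
  moreover have "((\<lambda>y. \<phi> (- y)) has_real_derivative (y - (- d)) powr q * (- v (- y))) (at y within {- d<..- c})"
    if "y \<in> {- d<..- c}" for y
  proof -
    have "(\<phi> has_real_derivative (d - (- y)) powr q * v (- y)) (at (- y) within uminus ` {- d<..- c})"
      using der[of "- y"] that by auto
    then have "(\<phi> \<circ> uminus has_real_derivative (d - (- y)) powr q * v (- y) * (-1)) (at y within {- d<..- c})"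
      by (rule DERIV_image_chain) (auto intro!: derivative_eq_intros)
    then show ?thesis
      by (simp add: o_def add.commute)
  qed
  ultimately show ?thesis
    using q unfolding C1_left_def by blast
qed

lemma RL_right_defined:
  assumes "c < d" "K \<in> Cm1 (d - c)" "\<phi> \<in> C1_right (\<lambda>y. y) c d" "x \<in> {c..<d}"
  shows "x \<in> dom (RL_right K c d \<phi>)"
  using RL_left_defined[of "- d" "- c" K, OF _ _ C1_right_reflect[OF assms(3)], of "- x"] assms
  by (simp add: domIff RL_right_eq_RL_left_reflect)

section \<open>Conjugation of both fractional derivatives by the substitution\<close>

theorem proposition5:
  fixes a b :: real and g M K f :: "real \<Rightarrow> real"
  assumes "a < b"
    and "(M, K) \<in> Luchko (b - a)"
    and "strict_mono_on {a..<b} g"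
    and "\<forall>x\<in>{a..<b}. 0 < g x"
    and "continuous_on {a..b} g"
    and "\<forall>x\<in>{a<..<b}. (g has_real_derivative deriv g x) (at x)"
    and "continuous_on {a<..<b} (deriv g)"
    and "\<forall>x\<in>{a<..<b}. deriv g x \<noteq> 0"
  shows
    "(f \<in> C1_left g a b \<or> Qinv a b g f \<in> C1_left (\<lambda>y. y) (g a) (g b) \<longrightarrow>
       (\<forall>x. x \<in> {a<..<b} \<or> x = b \<and> nonzero_der1 a b g b \<longrightarrow>
          RL_left_par K g a b f x = Qop g (RL_left K (g a) (g b) (Qinv a b g f)) x \<and>
          (K \<in> Cm1 (g b - g a) \<and> Qinv a b g f \<in> C1_left (\<lambda>y. y) (g a) (g b) \<longrightarrow>
             x \<in> dom (RL_left_par K g a b f)))) \<and>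
     (f \<in> C1_right g a b \<or> Qinv a b g f \<in> C1_right (\<lambda>y. y) (g a) (g b) \<longrightarrow>
       (\<forall>x. x \<in> {a<..<b} \<or> x = a \<and> nonzero_der1 a b g a \<longrightarrow>
          RL_right_par K g a b f x = Qop g (RL_right K (g a) (g b) (Qinv a b g f)) x \<and>
          (K \<in> Cm1 (g b - g a) \<and> Qinv a b g f \<in> C1_right (\<lambda>y. y) (g a) (g b) \<longrightarrow>
             x \<in> dom (RL_right_par K g a b f))))"
proof -
  interpret monotone_substitution a b g
    using assms by unfold_locales (auto intro: strict_mono_on_Icc_of_Ico)
  \<comment> \<open>At interior points the nonzero derivative is given; at the end point it is the
    extra condition on \<open>x\<close>.\<close>
  have left: "RL_left_par K g a b f x = RL_left K (g a) (g b) (Qinv a b g f) (g x)" "g x \<in> {g a<..g b}"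
    if "x \<in> {a<..<b} \<or> x = b \<and> nonzero_der1 a b g b" for x
    using that ab nonzero_der1_interior[of x] g_less[of a x] g_less[of x b]
    by (auto intro!: RL_left_par_eq)
  have right: "RL_right_par K g a b f x = RL_right K (g a) (g b) (Qinv a b g f) (g x)" "g x \<in> {g a..<g b}"
    if "x \<in> {a<..<b} \<or> x = a \<and> nonzero_der1 a b g a" for x
    using that ab nonzero_der1_interior[of x] g_less[of a x] g_less[of x b]
    by (auto intro!: RL_right_par_eq)
  have "g a < g b"
    using ab g_less by simp
  \<comment> \<open>The equalities carry definedness from the image interval back to the original
    one; that interval has length \<open>g b - g a\<close>, whence the kernel class on this
    length.\<close>
  then show ?thesis
    using left right RL_left_defined[of "g a" "g b" K "Qinv a b g f"]
      RL_right_defined[of "g a" "g b" K "Qinv a b g f"]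
    by (simp add: Qop_def domIff)
qed

end
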